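(* Let $m \ge 1$ and $N \ge 1$ be integers, and let $X_1, \dots, X_m$, $F_1,\dots,F_m$, $G$ and $A_{(i_1,\dots,i_m)}$ (for all nonnegative integers $i_1,\dots,i_m$ with $2 \le i_1+\cdots+i_m \le N$) be $n\times n$ complex matrices such that $$\sum_{k=2}^{N}\ \sum_{\substack{i_1,\dots,i_m \ge 0\\ i_1+\cdots+i_m = k}} X_1^{i_1} X_2^{i_2}\cdots X_m^{i_m} A_{(i_1,\dots,i_m)} + \sum_{s=1}^m X_s F_s + G = 0 .$$ Suppose that the matrices $X_1,\dots,X_m$ have a common set of left eigenvectors corresponding to all their eigenvalues (not necessarily the same eigenvalues for different $X_s$). Then all the eigenvalues of $X_1,\dots,X_m$ are zeros of the multivariate determinantal polynomial $$\det\left(\sum_{k=2}^{N}\ \sum_{\substack{i_1,\dots,i_m \ge 0\\ i_1+\cdots+i_m = k}} \mu_1^{i_1} \mu_2^{i_2}\cdots \mu_m^{i_m} A_{(i_1,\dots,i_m)} + \sum_{s=1}^m \mu_s F_s + G\right),$$ in the sense that this determinant vanishes at every tuple $(\mu_1,\dots,\mu_m)$ of corresponding eigenvalues of $X_1,\dots,X_m$.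
   Context: A tuple $(\mu_1,\dots,\mu_m)$, with $\mu_s$ an eigenvalue of $X_s$, is called a tuple of corresponding eigenvalues if there is a nonzero row vector $g$ (a common left eigenvector) with $gX_s = \mu_s g$ for all $s = 1,\dots,m$. "The matrices have a common set of left eigenvectors corresponding to all their eigenvalues" means that, for every $s$, every eigenvalue of $X_s$ occurs as the $s$-th entry of some tuple of corresponding eigenvalues. *)

theory Defs
  imports "Jordan_Normal_Form.Char_Poly"
begin

text \<open>Tuples indexed by \<open>1, \<dots>, m\<close> of matrices and of scalars are functions on \<open>nat\<close>
  of which only the values on \<open>{1..m}\<close> are used. Multi-indices also serve as summation
  indices, so they are taken extensional in order that each of them occurs exactly once.\<close>

definition multi_indices :: "nat \<Rightarrow> nat \<Rightarrow> (nat \<Rightarrow> nat) set" where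
  "multi_indices m k = {i \<in> {1..m} \<rightarrow>\<^sub>E UNIV. (\<Sum>s = 1..m. i s) = k}"

text \<open>The carrier record supplies finite sums \<open>\<Oplus>\<close> of \<open>n \<times> n\<close> matrices, as the type
  of matrices of arbitrary dimensions is not an instance of \<open>comm_monoid_add\<close>.\<close>

abbreviation cmat_ring :: "nat \<Rightarrow> complex mat ring" where
  "cmat_ring n \<equiv> ring_mat TYPE(complex) n ()"

text \<open>The ordered product \<open>X\<^sub>1\<^bsup>i\<^sub>1\<^esup> X\<^sub>2\<^bsup>i\<^sub>2\<^esup> \<dots> X\<^sub>m\<^bsup>i\<^sub>m\<^esup>\<close>; the matrices need not commute.\<close>

definition mat_monomial :: "nat \<Rightarrow> nat \<Rightarrow> (nat \<Rightarrow> complex mat) \<Rightarrow> (nat \<Rightarrow> nat) \<Rightarrow> complex mat" where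
  "mat_monomial n m X i = foldr (\<lambda>s P. X s ^\<^sub>m i s * P) [1..<Suc m] (1\<^sub>m n)"

definition left_eigenvector :: "complex mat \<Rightarrow> complex vec \<Rightarrow> complex \<Rightarrow> bool" where
  "left_eigenvector M g c \<longleftrightarrow>
     g \<in> carrier_vec (dim_row M) \<and> g \<noteq> 0\<^sub>v (dim_row M) \<and>
     mat_of_row g * M = c \<cdot>\<^sub>m mat_of_row g"

definition corresponding_eigenvalues :: "nat \<Rightarrow> (nat \<Rightarrow> complex mat) \<Rightarrow> (nat \<Rightarrow> complex) \<Rightarrow> bool" where
  "corresponding_eigenvalues m X \<mu> \<longleftrightarrow>
     (\<forall>s\<in>{1..m}. eigenvalue (X s) (\<mu> s)) \<and>
     (\<exists>g. \<forall>s\<in>{1..m}. left_eigenvector (X s) g (\<mu> s))"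

definition common_left_eigenvectors :: "nat \<Rightarrow> (nat \<Rightarrow> complex mat) \<Rightarrow> bool" where
  "common_left_eigenvectors m X \<longleftrightarrow>
     (\<forall>s\<in>{1..m}. \<forall>c. eigenvalue (X s) c \<longrightarrow>
        (\<exists>\<mu>. corresponding_eigenvalues m X \<mu> \<and> \<mu> s = c))"

lemma finite_multi_indices: "finite (multi_indices m k)"
proof (rule finite_subset)
  show "multi_indices m k \<subseteq> {1..m} \<rightarrow>\<^sub>E {..k}"
  proof
    fix i assume i: "i \<in> multi_indices m k"
    have "i s \<le> k" if "s \<in> {1..m}" for s
      using i member_le_sum[of s "{1..m}" i] that by (auto simp: multi_indices_def)
    with i show "i \<in> {1..m} \<rightarrow>\<^sub>E {..k}"
      by (auto simp: multi_indices_def PiE_iff)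
  qed
qed (auto intro: finite_PiE)

lemma mat_monomial_carrier:
  assumes "\<And>s. s \<in> {1..m} \<Longrightarrow> X s \<in> carrier_mat n n"
  shows "mat_monomial n m X i \<in> carrier_mat n n"
proof -
  have "foldr (\<lambda>s P. X s ^\<^sub>m i s * P) ss (1\<^sub>m n) \<in> carrier_mat n n"
    if "set ss \<subseteq> {1..m}" for ss
    using that by (induction ss) (auto intro!: mult_carrier_mat pow_carrier_mat assms)
  then show ?thesis
    unfolding mat_monomial_def by (simp del: upt_Suc add: subset_eq)
qed

end

theory Submission
  imports Defs
begin

text \<open>The common left eigenvector \<open>g\<close> of a corresponding tuple \<open>\<mu>\<close> cannot tell \<open>X\<^sub>s\<close> from
  the scalar \<open>\<mu>\<^sub>s\<close>: multiplying a monomial in the \<open>X\<^sub>s\<close> by \<open>g\<close> from the left peels off the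
  factors one after the other, so that
  \<open>g X\<^sub>1\<^bsup>i\<^sub>1\<^esup> \<dots> X\<^sub>m\<^bsup>i\<^sub>m\<^esup> = \<mu>\<^sub>1\<^bsup>i\<^sub>1\<^esup> \<dots> \<mu>\<^sub>m\<^bsup>i\<^sub>m\<^esup> g\<close>, whether or not the \<open>X\<^sub>s\<close> commute
  (\<open>left_eigenvector_mat_monomial\<close>). As the coefficients stand to the right of the monomials,
  the left-hand side of the matrix equation and the matrix inside the determinant therefore
  have the same product with \<open>g\<close> (\<open>mult_finsum_mat_cong\<close> carries this through the sums).
  The former product is \<open>0\<close>, so \<open>g \<noteq> 0\<close> is a left null vector of the latter matrix, which is
  thus singular (\<open>det_eq_0_if_left_null_vector\<close>).\<close>

lemma finsum_mat_carrier:
  assumes "\<And>i. i \<in> I \<Longrightarrow> P i \<in> carrier_mat n n"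
  shows "(\<Oplus>\<^bsub>cmat_ring n\<^esub>i\<in>I. P i) \<in> carrier_mat n n"
proof -
  interpret ring "cmat_ring n" by (rule ring_mat)
  show ?thesis using finsum_closed[of P I] assms by (auto simp: ring_mat_def)
qed

lemma mult_finsum_mat_cong:
  assumes "R \<in> carrier_mat r n"
    and "\<And>i. i \<in> I \<Longrightarrow> P i \<in> carrier_mat n n"
    and "\<And>i. i \<in> I \<Longrightarrow> Q i \<in> carrier_mat n n"
    and "\<And>i. i \<in> I \<Longrightarrow> R * P i = R * Q i"
  shows "R * (\<Oplus>\<^bsub>cmat_ring n\<^esub>i\<in>I. P i) = R * (\<Oplus>\<^bsub>cmat_ring n\<^esub>i\<in>I. Q i)"
proof -
  interpret ring "cmat_ring n" by (rule ring_mat)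
  from assms(2-) show ?thesis
  proof (induction I rule: infinite_finite_induct)
    case (insert j I)
    have sums: "(\<Oplus>\<^bsub>cmat_ring n\<^esub>i\<in>insert j I. P i) = P j + (\<Oplus>\<^bsub>cmat_ring n\<^esub>i\<in>I. P i)"
      "(\<Oplus>\<^bsub>cmat_ring n\<^esub>i\<in>insert j I. Q i) = Q j + (\<Oplus>\<^bsub>cmat_ring n\<^esub>i\<in>I. Q i)"
      using finsum_insert[of I j P] finsum_insert[of I j Q] insert
      by (auto simp: ring_mat_def)
    have carriers: "P j \<in> carrier_mat n n" "(\<Oplus>\<^bsub>cmat_ring n\<^esub>i\<in>I. P i) \<in> carrier_mat n n"
      "Q j \<in> carrier_mat n n" "(\<Oplus>\<^bsub>cmat_ring n\<^esub>i\<in>I. Q i) \<in> carrier_mat n n"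
      using insert.prems by (auto intro: finsum_mat_carrier)
    have "R * P j = R * Q j" "R * (\<Oplus>\<^bsub>cmat_ring n\<^esub>i\<in>I. P i) = R * (\<Oplus>\<^bsub>cmat_ring n\<^esub>i\<in>I. Q i)"
      using insert by auto
    then show ?case
      unfolding sums mult_add_distrib_mat[OF assms(1) carriers(1,2)]
        mult_add_distrib_mat[OF assms(1) carriers(3,4)] by simp
  qed simp_all
qed

lemma left_eigen_pow_mat:
  assumes R: "R \<in> carrier_mat r n" and M: "M \<in> carrier_mat n n"
    and eigen: "R * M = (c :: 'a :: comm_semiring_1) \<cdot>\<^sub>m R"
  shows "R * M ^\<^sub>m k = c ^ k \<cdot>\<^sub>m R"
proof (induction k)
  case 0
  show ?case using R M by auto
next
  case (Suc k)
  have "R * M ^\<^sub>m Suc k = (R * M ^\<^sub>m k) * M"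
    using assoc_mult_mat[OF R pow_carrier_mat[OF M] M] by simp
  also have "\<dots> = c ^ k \<cdot>\<^sub>m (R * M)"
    using Suc R M by (simp add: mult_smult_assoc_mat[of R r n])
  also have "\<dots> = c ^ Suc k \<cdot>\<^sub>m R"
    unfolding eigen by (auto simp: ac_simps)
  finally show ?case .
qed

lemma left_eigenvector_mat_monomial:
  assumes R: "R \<in> carrier_mat r n"
    and X: "\<And>s. s \<in> {1..m} \<Longrightarrow> X s \<in> carrier_mat n n"
    and eigen: "\<And>s. s \<in> {1..m} \<Longrightarrow> R * X s = \<mu> s \<cdot>\<^sub>m R"
  shows "R * mat_monomial n m X i = (\<Prod>s = 1..m. \<mu> s ^ i s) \<cdot>\<^sub>m R"
proof -
  \<comment> \<open>Only a tail of the list \<open>[1..<Suc m]\<close> is left after some factors have been peeled off.\<close>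
  have "foldr (\<lambda>s P. X s ^\<^sub>m i s * P) ss (1\<^sub>m n) \<in> carrier_mat n n \<and>
      R * foldr (\<lambda>s P. X s ^\<^sub>m i s * P) ss (1\<^sub>m n) = (\<Prod>s\<leftarrow>ss. \<mu> s ^ i s) \<cdot>\<^sub>m R"
    if "set ss \<subseteq> {1..m}" for ss
    using that
  proof (induction ss)
    case Nil
    show ?case using R by auto
  next
    case (Cons s ss)
    define P where "P = foldr (\<lambda>s P. X s ^\<^sub>m i s * P) ss (1\<^sub>m n)"
    have P: "P \<in> carrier_mat n n" "R * P = (\<Prod>s\<leftarrow>ss. \<mu> s ^ i s) \<cdot>\<^sub>m R"
      using Cons by (auto simp: P_def)
    have s: "s \<in> {1..m}" using Cons.prems by simp
    have pow: "X s ^\<^sub>m i s \<in> carrier_mat n n"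
      using X[OF s] by (rule pow_carrier_mat)
    have "R * (X s ^\<^sub>m i s * P) = (R * X s ^\<^sub>m i s) * P"
      using assoc_mult_mat[OF R pow P(1)] by simp
    also have "\<dots> = \<mu> s ^ i s \<cdot>\<^sub>m (R * P)"
      using left_eigen_pow_mat[OF R X[OF s] eigen[OF s]] R P(1)
      by (simp add: mult_smult_assoc_mat[of R r n])
    also have "\<dots> = (\<Prod>s\<leftarrow>s # ss. \<mu> s ^ i s) \<cdot>\<^sub>m R"
      unfolding P(2) by (auto simp: ac_simps)
    finally show ?case
      using pow P(1) by (simp add: P_def)
  qed
  from this[of "[1..<Suc m]"] show ?thesis
    by (simp del: upt_Suc add: mat_monomial_def subset_eq atLeastLessThanSuc_atLeastAtMost
        flip: prod.distinct_set_conv_list)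
qed

text \<open>The vectors in the library criterion for \<open>det M = 0\<close> are columns, whence the transpose.\<close>

lemma det_eq_0_if_left_null_vector:
  assumes M: "(M :: 'a :: field mat) \<in> carrier_mat n n"
    and g: "g \<in> carrier_vec n" "g \<noteq> 0\<^sub>v n"
    and null: "mat_of_row g * M = 0\<^sub>m 1 n"
  shows "det M = 0"
proof -
  have "M\<^sup>T *\<^sub>v g = 0\<^sub>v n"
  proof (rule eq_vecI)
    fix j assume "j < dim_vec (0\<^sub>v n :: 'a vec)"
    then have j: "j < n" by simp
    have "(M\<^sup>T *\<^sub>v g) $ j = g \<bullet> col M j"
      using M g(1) j by (simp add: comm_scalar_prod[of _ n])
    also have "\<dots> = (mat_of_row g * M) $$ (0, j)"
      using M j by simp
    finally show "(M\<^sup>T *\<^sub>v g) $ j = 0\<^sub>v n $ j"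
      using j by (simp add: null)
  qed (use M in simp)
  with g have "det M\<^sup>T = 0"
    using det_0_iff_vec_prod_zero[of "M\<^sup>T" n] M by auto
  with det_transpose[OF M] show ?thesis by simp
qed

theorem lemma5:
  fixes m n N :: nat
    and X F :: "nat \<Rightarrow> complex mat"
    and G :: "complex mat"
    and A :: "(nat \<Rightarrow> nat) \<Rightarrow> complex mat"
  assumes "m \<ge> 1" and "N \<ge> 1"
    and X: "\<And>s. s \<in> {1..m} \<Longrightarrow> X s \<in> carrier_mat n n"
    and F: "\<And>s. s \<in> {1..m} \<Longrightarrow> F s \<in> carrier_mat n n"
    and G: "G \<in> carrier_mat n n"
    and A: "\<And>k i. k \<in> {2..N} \<Longrightarrow> i \<in> multi_indices m k \<Longrightarrow> A i \<in> carrier_mat n n"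
    and equation:
      "(\<Oplus>\<^bsub>cmat_ring n\<^esub>k\<in>{2..N}. \<Oplus>\<^bsub>cmat_ring n\<^esub>i\<in>multi_indices m k. mat_monomial n m X i * A i)
        + (\<Oplus>\<^bsub>cmat_ring n\<^esub>s\<in>{1..m}. X s * F s) + G = 0\<^sub>m n n"
    and common: "common_left_eigenvectors m X"
  shows "\<forall>\<mu>. corresponding_eigenvalues m X \<mu> \<longrightarrow>
    det ((\<Oplus>\<^bsub>cmat_ring n\<^esub>k\<in>{2..N}. \<Oplus>\<^bsub>cmat_ring n\<^esub>i\<in>multi_indices m k. (\<Prod>s = 1..m. \<mu> s ^ i s) \<cdot>\<^sub>m A i)
        + (\<Oplus>\<^bsub>cmat_ring n\<^esub>s\<in>{1..m}. \<mu> s \<cdot>\<^sub>m F s) + G) = 0"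
proof (intro allI impI)
  fix \<mu> assume "corresponding_eigenvalues m X \<mu>"
  then obtain g where eigenvec: "\<And>s. s \<in> {1..m} \<Longrightarrow> left_eigenvector (X s) g (\<mu> s)"
    unfolding corresponding_eigenvalues_def by blast
  define R where "R = mat_of_row g"
  \<comment> \<open>It takes one of the \<open>X s\<close> to know that \<open>g\<close> is a nonzero vector of dimension \<open>n\<close>.\<close>
  have g: "g \<in> carrier_vec n" "g \<noteq> 0\<^sub>v n"
    using eigenvec[of 1] X[of 1] \<open>m \<ge> 1\<close> by (auto simp: left_eigenvector_def)
  have R: "R \<in> carrier_mat 1 n"
    using g(1) by (auto simp: R_def)
  have eigen: "R * X s = \<mu> s \<cdot>\<^sub>m R" if "s \<in> {1..m}" for s
    using eigenvec[OF that] by (simp add: left_eigenvector_def R_def)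

  let ?SX = "\<Oplus>\<^bsub>cmat_ring n\<^esub>k\<in>{2..N}. \<Oplus>\<^bsub>cmat_ring n\<^esub>i\<in>multi_indices m k. mat_monomial n m X i * A i"
  let ?S\<mu> = "\<Oplus>\<^bsub>cmat_ring n\<^esub>k\<in>{2..N}. \<Oplus>\<^bsub>cmat_ring n\<^esub>i\<in>multi_indices m k. (\<Prod>s = 1..m. \<mu> s ^ i s) \<cdot>\<^sub>m A i"
  let ?LX = "\<Oplus>\<^bsub>cmat_ring n\<^esub>s\<in>{1..m}. X s * F s"
  let ?L\<mu> = "\<Oplus>\<^bsub>cmat_ring n\<^esub>s\<in>{1..m}. \<mu> s \<cdot>\<^sub>m F s"

  have pull: "R * (M * B) = R * (c \<cdot>\<^sub>m B)"
    if "M \<in> carrier_mat n n" "B \<in> carrier_mat n n" "R * M = c \<cdot>\<^sub>m R" for M B c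
    using that R
    by (simp add: mult_smult_assoc_mat[of R 1 n] mult_smult_distrib[of R 1 n]
        flip: assoc_mult_mat[of R 1 n])

  have monomial: "mat_monomial n m X i \<in> carrier_mat n n" for i
    using X by (rule mat_monomial_carrier)
  have carriers: "?SX \<in> carrier_mat n n" "?S\<mu> \<in> carrier_mat n n"
    "?LX \<in> carrier_mat n n" "?L\<mu> \<in> carrier_mat n n"
    by (auto intro!: finsum_mat_carrier mult_carrier_mat smult_carrier_mat
        intro: monomial A X F)
  have S: "R * ?SX = R * ?S\<mu>"
  proof (intro mult_finsum_mat_cong[OF R] finsum_mat_carrier)
    fix k i assume ki: "k \<in> {2..N}" "i \<in> multi_indices m k"
    show "R * (mat_monomial n m X i * A i) = R * ((\<Prod>s = 1..m. \<mu> s ^ i s) \<cdot>\<^sub>m A i)"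
      by (intro pull monomial A[OF ki] left_eigenvector_mat_monomial[OF R X eigen])
  qed (auto intro!: mult_carrier_mat smult_carrier_mat intro: monomial A)
  have L: "R * ?LX = R * ?L\<mu>"
    by (rule mult_finsum_mat_cong[OF R])
      (auto intro!: pull mult_carrier_mat smult_carrier_mat X F eigen)

  have distrib: "R * (S + L + G) = R * S + R * L + R * G"
    if "S \<in> carrier_mat n n" "L \<in> carrier_mat n n" for S L
    unfolding mult_add_distrib_mat[OF R add_carrier_mat[OF that(2)] G]
      mult_add_distrib_mat[OF R that] by simp
  have "R * (?S\<mu> + ?L\<mu> + G) = R * (?SX + ?LX + G)"
    by (simp only: distrib carriers S L)
  also have "\<dots> = 0\<^sub>m 1 n"
    using R by (simp only: equation right_mult_zero_mat)
  finally show "det (?S\<mu> + ?L\<mu> + G) = 0"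
    using det_eq_0_if_left_null_vector[OF _ g] carriers G by (simp add: R_def)
qed

end
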